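(* $$\sum_{k=1}^{n}\lambda(\mathcal{C}_k)\sim\frac{n}{\log_2 n}\qquad(n\to\infty),$$ where $\lambda$ denotes Lebesgue measure on $[0,1]$ and $\mathcal{C}_k$ is the $k$-th sum-level set for regular continued fractions.
   Context: For positive integers $a_1,a_2,\ldots$, $[a_1,a_2,\ldots]:=\cfrac{1}{a_1+\cfrac{1}{a_2+\cdots}}$ denotes the regular continued fraction with these entries; Lebesgue-almost every $x\in[0,1]$ (every irrational) has a unique such infinite expansion. For $n\in\mathbb{N}=\{1,2,\ldots\}$ the sum-level set is $$\mathcal{C}_n:=\Big\{[a_1,a_2,\ldots]\in[0,1]:\ \sum_{i=1}^{k}a_i=n\ \text{for some }k\in\mathbb{N}\Big\}.$$ $\log_2$ is the logarithm to base $2$, and $b_n\sim c_n$ means $\lim_{n\to\infty}b_n/c_n=1$. *)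

theory Defs
  imports "HOL-Analysis.Analysis" "HOL-Library.Landau_Symbols"
begin

text \<open>Entries are indexed from 1 as in the usual notation; the value \<open>a 0\<close> is never used.
  \<open>cf_conv a n\<close> is the finite continued fraction \<open>[a 1, \<dots>, a n]\<close>.\<close>

fun cf_conv :: "(nat \<Rightarrow> nat) \<Rightarrow> nat \<Rightarrow> real" where
  "cf_conv a 0 = 0"
| "cf_conv a (Suc n) = 1 / (real (a 1) + cf_conv (\<lambda>i. a (Suc i)) n)"

text \<open>The limit exists whenever all \<open>a i\<close> with \<open>i \<ge> 1\<close> are positive, the only case used below.\<close>

definition cf_value :: "(nat \<Rightarrow> nat) \<Rightarrow> real" where
  "cf_value a = lim (cf_conv a)"

definition sum_level_set :: "nat \<Rightarrow> real set" where
  "sum_level_set n =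
     {x \<in> {0..1}. \<exists>a. (\<forall>i\<ge>1. a i > 0) \<and> x = cf_value a \<and> (\<exists>k\<ge>1. (\<Sum>i=1..k. a i) = n)}"

end

theory Submission
  imports Defs "HOL-Real_Asymp.Real_Asymp"
begin

text \<open>
  Write \<open>w n\<close> for the Lebesgue measure of the \<open>n\<close>-th sum-level set, with \<open>w 0 = 1\<close>. The idea is to measure the
  level sets by \<open>dx / x\<close> in two ways.

  This measure is invariant under the Farey map, and raising the level by one amounts to taking the preimage
  under that map. Hence all sum-level sets have the same mass \<open>ln 2\<close> (\<open>level_log_measure\<close>).
  On the other hand, the part of the \<open>n\<close>-th level set with first digit \<open>j\<close> is the image of the
  level set \<open>n - j\<close> under \<open>z \<mapsto> 1 / (j + z)\<close>, and this map turns \<open>dx / x\<close> into \<open>dz / (j + z)\<close>.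
  Since \<open>z\<close> is between \<open>0\<close> and \<open>1\<close>, comparison with Lebesgue measure gives
  (\<open>level_renewal_bounds\<close>)
  \<open>(\<Sum>j=1..n. w (n - j) / (j + 1)) \<le> ln 2 \<le> (\<Sum>j=1..n. w (n - j) / j)\<close>.

  These are renewal inequalities with harmonic weights. Summed over \<open>n\<close> they say that the
  partial sums of \<open>w\<close>, convolved with \<open>1 / j\<close>, grow like \<open>n * ln 2\<close>. The partial sums are monotone and
  the harmonic numbers grow as slowly as \<open>ln n\<close>, so the convolution may be replaced by a product
  (\<open>renewal_sums_asymp\<close>): the partial sums are asymptotic to \<open>n * ln 2 / ln n\<close>.

  The set-theoretic input is that irrational numbers have infinite continued fraction expansions, so that
  \<open>w 0 = 1\<close>, and that expansions can be decomposed by their first digit.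
\<close>

section \<open>Convergence of infinite continued fractions\<close>

text \<open>The value \<open>[a 1, \<dots>, a n + z]\<close>: keeping the tail \<open>z\<close> as a real argument lets
  convergents and exact expansions be compared by one contraction estimate.\<close>

fun cf_tail :: "(nat \<Rightarrow> nat) \<Rightarrow> nat \<Rightarrow> real \<Rightarrow> real" where
  "cf_tail a 0 z = z"
| "cf_tail a (Suc n) z = 1 / (real (a 1) + cf_tail (\<lambda>i. a (Suc i)) n z)"

lemma cf_conv_eq_cf_tail: "cf_conv a n = cf_tail a n 0"
  by (induction a n rule: cf_conv.induct) auto

lemma cf_tail_range:
  assumes "\<forall>i\<ge>1. a i > 0" "z \<in> {0..1}"
  shows "cf_tail a n z \<in> {0..1}"
  using assms
proof (induction a n z rule: cf_tail.induct)
  case (2 a n z)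
  have "real (a 1) \<ge> 1" using 2(2) by (simp add: Suc_leI)
  moreover have "cf_tail (\<lambda>i. a (Suc i)) n z \<in> {0..1}" using 2 by simp
  ultimately show ?case by (simp add: divide_le_eq_1)
qed simp

lemma cf_tail_append:
  "cf_tail a (m + n) z = cf_tail a m (cf_tail (\<lambda>i. a (i + m)) n z)"
  by (induction m arbitrary: a) simp_all

text \<open>A single step \<open>z \<mapsto> 1 / (c + z)\<close> has slope \<open>-1\<close> at \<open>z = 0\<close> when \<open>c = 1\<close>, so it is not a uniform
  contraction of the unit interval. Two steps are: the composition is a Moebius map of
  determinant one, whose denominator \<open>b * (c + u) + 1\<close> is at least two.\<close>

lemma two_branches_contract:
  fixes b c u v :: real
  assumes "b \<ge> 1" "c \<ge> 1" "u \<ge> 0" "v \<ge> 0"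
  shows "\<bar>1 / (b + 1 / (c + u)) - 1 / (b + 1 / (c + v))\<bar> \<le> \<bar>u - v\<bar> / 4"
proof -
  have ge: "b * (c + w) + 1 \<ge> 2" if "w \<ge> 0" for w
    using mult_mono[of 1 b 1 "c + w"] assms that by simp
  have eq: "1 / (b + 1 / (c + w)) = (c + w) / (b * (c + w) + 1)" if "w \<ge> 0" for w
    using assms that by (simp add: field_simps)
  have pos: "b * (c + w) + 1 \<noteq> 0" if "w \<ge> 0" for w
    using ge[OF that] by simp
  have "1 / (b + 1 / (c + u)) - 1 / (b + 1 / (c + v))
      = (u - v) / ((b * (c + u) + 1) * (b * (c + v) + 1))"
    using assms pos[of u] pos[of v] unfolding eq[OF assms(3)] eq[OF assms(4)]
    by (simp add: diff_frac_eq) (simp add: algebra_simps)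
  moreover have "4 \<le> (b * (c + u) + 1) * (b * (c + v) + 1)"
    using mult_mono[OF ge[OF assms(3)] ge[OF assms(4)]] ge[OF assms(3)] by simp
  moreover have "\<bar>u - v\<bar> / D \<le> \<bar>u - v\<bar> / 4" if "4 \<le> D" for D
    using that by (intro divide_left_mono) auto
  ultimately show ?thesis
    by (simp add: abs_divide)
qed

text \<open>Each pair of steps gains a factor \<open>1 / 4\<close>, hence \<open>1 / 2\<close> per step on average; the leading \<open>2\<close>
  pays for the one unpaired step when \<open>n\<close> is odd.\<close>

lemma cf_tail_contract:
  assumes "\<forall>i\<ge>1. a i > 0" "z \<in> {0..1}" "w \<in> {0..1}"
  shows "\<bar>cf_tail a n z - cf_tail a n w\<bar> \<le> 2 * (1 / 2) ^ n"
  using assms(1)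
proof (induction n arbitrary: a rule: induct_nat_012)
  case 0
  then show ?case using assms(2,3) by auto
next
  case 1
  have "cf_tail a 1 z \<in> {0..1}" "cf_tail a 1 w \<in> {0..1}"
    using cf_tail_range[OF 1] assms(2,3) by blast+
  then have "\<bar>cf_tail a 1 z - cf_tail a 1 w\<bar> \<le> 1"
    unfolding atLeastAtMost_iff by linarith
  then show ?case by simp
next
  case (ge2 n)
  let ?b = "\<lambda>i. a (Suc (Suc i))"
  have pos: "\<forall>i\<ge>1. ?b i > 0" using ge2.prems by simp
  have ge: "real (a 1) \<ge> 1" "real (a 2) \<ge> 1" using ge2.prems by (simp_all add: Suc_leI)
  have "\<bar>cf_tail a (Suc (Suc n)) z - cf_tail a (Suc (Suc n)) w\<bar>
      \<le> \<bar>cf_tail ?b n z - cf_tail ?b n w\<bar> / 4"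
    using two_branches_contract[OF ge] cf_tail_range[OF pos] assms(2,3)
    by (simp add: numeral_2_eq_2)
  also have "\<dots> \<le> 2 * (1 / 2) ^ Suc (Suc n)"
    using ge2.IH(1)[OF pos] by simp
  finally show ?case .
qed

lemma cf_error_tendsto_0: "(\<lambda>n. 2 * (1 / 2) ^ n :: real) \<longlonglongrightarrow> 0"
  by real_asymp

lemma cf_conv_tendsto_of_tails:
  assumes "\<forall>i\<ge>1. a i > 0" "\<And>n. z n \<in> {0..1}" "\<And>n. x = cf_tail a n (z n)"
  shows "cf_conv a \<longlonglongrightarrow> x"
proof -
  have "\<bar>cf_conv a n - x\<bar> \<le> 2 * (1 / 2) ^ n" for n
    using cf_tail_contract[OF assms(1), of 0 "z n" n] assms(2)[of n] assms(3)[of n]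
    by (simp add: cf_conv_eq_cf_tail)
  then show ?thesis
    by (intro LIM_zero_cancel[of _ x] Lim_null_comparison[OF _ cf_error_tendsto_0]) simp
qed

lemma cf_conv_convergent:
  assumes "\<forall>i\<ge>1. a i > 0"
  shows "convergent (cf_conv a)"
proof -
  have close: "\<bar>cf_conv a (n + p) - cf_conv a n\<bar> \<le> 2 * (1 / 2) ^ n" for n p
    using cf_tail_contract[OF assms, of "cf_tail (\<lambda>i. a (i + n)) p 0" 0 n]
      cf_tail_range[of "\<lambda>i. a (i + n)" 0 p] assms
    by (simp add: cf_conv_eq_cf_tail cf_tail_append)
  have "Cauchy (cf_conv a)"
  proof (rule metric_CauchyI)
    fix e :: real assume "e > 0"
    then obtain M where M: "\<And>n. n \<ge> M \<Longrightarrow> 2 * (1 / 2) ^ n < e / 2"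
      using order_tendstoD(2)[OF cf_error_tendsto_0, of "e / 2"]
      by (auto simp: eventually_sequentially)
    have "\<bar>cf_conv a m - cf_conv a M\<bar> < e / 2" if "m \<ge> M" for m
      using close[of M "m - M"] M[of M] that by simp
    then show "\<exists>M. \<forall>m\<ge>M. \<forall>n\<ge>M. dist (cf_conv a m) (cf_conv a n) < e"
      by (intro exI[of _ M] allI impI) (smt (verit) dist_real_def field_sum_of_halves)
  qed
  then show ?thesis by (rule Cauchy_convergent)
qed

lemma cf_conv_tendsto: "\<forall>i\<ge>1. a i > 0 \<Longrightarrow> cf_conv a \<longlonglongrightarrow> cf_value a"
  unfolding cf_value_def using cf_conv_convergent convergent_LIMSEQ_iff by blast

lemma cf_value_range:
  assumes "\<forall>i\<ge>1. a i > 0"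
  shows "cf_value a \<in> {0..1}"
  by (rule closed_sequentially[OF _ _ cf_conv_tendsto[OF assms]])
     (use cf_tail_range[OF assms, of 0] in \<open>auto simp: cf_conv_eq_cf_tail\<close>)

definition cf_branch :: "nat \<Rightarrow> real \<Rightarrow> real" where
  "cf_branch j z = 1 / (real j + z)"

text \<open>The recursion of the convergents passes to the limit, because the branch is continuous away from
  its pole \<open>- a 1\<close> and values lie in the unit interval.\<close>

lemma cf_value_eq_branch:
  assumes "\<forall>i\<ge>1. a i > 0"
  shows "cf_value a = cf_branch (a 1) (cf_value (\<lambda>i. a (Suc i)))"
proof -
  let ?b = "\<lambda>i. a (Suc i)"
  have pos: "\<forall>i\<ge>1. ?b i > 0" using assms by simp
  have ne: "real (a 1) + cf_value ?b \<noteq> 0"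
    using cf_value_range[OF pos] assms[rule_format, of 1] by simp
  have "(\<lambda>n. cf_conv a (Suc n)) \<longlonglongrightarrow> 1 / (real (a 1) + cf_value ?b)"
    unfolding cf_conv.simps by (intro tendsto_intros cf_conv_tendsto[OF pos] ne)
  moreover have "(\<lambda>n. cf_conv a (Suc n)) \<longlonglongrightarrow> cf_value a"
    using cf_conv_tendsto[OF assms] by (rule LIMSEQ_Suc)
  ultimately show ?thesis unfolding cf_branch_def by (rule LIMSEQ_unique[symmetric])
qed

lemma cf_conv_cong:
  "(\<And>i. i \<ge> 1 \<Longrightarrow> a i = b i) \<Longrightarrow> cf_conv a n = cf_conv b n"
proof (induction n arbitrary: a b)
  case (Suc n)
  have "cf_conv (\<lambda>i. a (Suc i)) n = cf_conv (\<lambda>i. b (Suc i)) n"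
    by (rule Suc.IH) (simp add: Suc.prems)
  then show ?case using Suc.prems[of 1] by simp
qed simp

lemma cf_value_cong:
  "(\<And>i. i \<ge> 1 \<Longrightarrow> a i = b i) \<Longrightarrow> cf_value a = cf_value b"
  unfolding cf_value_def using cf_conv_cong[of a b] by presburger

section \<open>Expansion of irrational numbers\<close>

fun gauss_orbit :: "real \<Rightarrow> nat \<Rightarrow> real" where
  "gauss_orbit x 0 = x"
| "gauss_orbit x (Suc n) = frac (1 / gauss_orbit x n)"

lemma gauss_orbit_irrational:
  assumes "x \<in> {0..1}" "x \<notin> \<rat>"
  shows "gauss_orbit x n \<in> {0<..<1} - \<rat>"
proof (induction n)
  case 0
  then show ?case using assms by (metis Diff_iff Rats_0 Rats_1 atLeastAtMost_iff gauss_orbit.simps(1) greaterThanLessThan_iff order_le_less)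
next
  case (Suc n)
  have "1 / gauss_orbit x n \<notin> \<rat>"
    using Suc by (metis DiffD2 Rats_divide Rats_1 div_by_1 divide_divide_eq_right mult_1)
  then have "frac (1 / gauss_orbit x n) \<notin> \<rat>"
    unfolding frac_def by (metis Rats_add Rats_of_int diff_add_cancel)
  then show ?case
    by (metis DiffI Rats_0 frac_ge_0 frac_lt_1 gauss_orbit.simps(2) greaterThanLessThan_iff order_le_less)
qed

text \<open>The greedy digits \<open>\<lfloor>1 / x\<rfloor>\<close> along the orbit of the Gauss map reproduce \<open>x\<close> exactly with the
  orbit points as tails, and the contraction makes the value of the tail irrelevant in the limit.
  Irrationality keeps the orbit away from \<open>0\<close>, where the algorithm would stop.\<close>

lemma irrational_is_cf_value:
  assumes "x \<in> {0..1}" "x \<notin> \<rat>"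
  shows "\<exists>a. (\<forall>i\<ge>1. a i > 0) \<and> x = cf_value a"
proof -
  define a where "a i = nat \<lfloor>1 / gauss_orbit x (i - 1)\<rfloor>" for i
  note orb = gauss_orbit_irrational[OF assms]
  have ge: "\<lfloor>1 / gauss_orbit x n\<rfloor> \<ge> 1" for n
    using orb[of n] by (simp add: le_floor_iff)
  have pos: "\<forall>i\<ge>1. a i > 0"
    using ge unfolding a_def by (smt (verit) zero_less_nat_eq)
  have step: "gauss_orbit x n = 1 / (real (a (Suc n)) + gauss_orbit x (Suc n))" for n
  proof -
    have "real (a (Suc n)) = of_int \<lfloor>1 / gauss_orbit x n\<rfloor>"
      using ge[of n] unfolding a_def by (simp del: one_le_floor)
    then have "real (a (Suc n)) + gauss_orbit x (Suc n) = 1 / gauss_orbit x n"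
      by (simp add: frac_def)
    then show ?thesis by simp
  qed
  have tail: "gauss_orbit x m = cf_tail (\<lambda>i. a (i + m)) n (gauss_orbit x (m + n))" for m n
  proof (induction n arbitrary: m)
    case (Suc n)
    show ?case using step[of m] Suc[of "Suc m"] by simp
  qed simp
  have "cf_conv a \<longlonglongrightarrow> x"
    by (rule cf_conv_tendsto_of_tails[OF pos, of "gauss_orbit x"])
       (use orb tail[of 0] in \<open>auto simp: less_imp_le\<close>)
  then have "x = cf_value a" unfolding cf_value_def by (simp add: limI)
  with pos show ?thesis by blast
qed

section \<open>Self-similarity of the level sets\<close>

text \<open>For \<open>n \<ge> 1\<close> these are the sum-level sets. Here the empty digit sum \<open>k = 0\<close> is admitted, which
  makes \<open>level 0\<close> the set of all values of infinite continued fractions; with this convention the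
  decomposition by the first digit needs no separate case for the digit \<open>n\<close> itself.\<close>

definition level :: "nat \<Rightarrow> real set" where
  "level n = {cf_value a |a. (\<forall>i\<ge>1. a i > 0) \<and> (\<exists>k. (\<Sum>i=1..k. a i) = n)}"

lemma level_eq_sum_level_set:
  assumes "n \<ge> 1"
  shows "level n = sum_level_set n"
proof -
  have "(\<exists>k. (\<Sum>i=1..k. a i) = n) \<longleftrightarrow> (\<exists>k\<ge>1. (\<Sum>i=1..k. a i) = n)" for a :: "nat \<Rightarrow> nat"
    using assms by (metis One_nat_def Suc_leI bot_nat_0.not_eq_extremum not_one_le_zero sum.neutral atLeastatMost_empty zero_less_one empty_iff)
  then show ?thesis
    unfolding level_def sum_level_set_def using cf_value_range by blast
qed

lemma level_subset: "level n \<subseteq> {0..1}"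
  using cf_value_range unfolding level_def by blast

lemma level_0: "level 0 = {cf_value a |a. \<forall>i\<ge>1. a i > 0}"
  unfolding level_def by (auto intro!: exI[of _ "0::nat"])

text \<open>After a first digit \<open>j\<close>, the remaining digits must have the partial sum \<open>n - j\<close>.\<close>

lemma level_first_digit:
  assumes "n \<ge> 1"
  shows "level n = (\<Union>j\<in>{1..n}. cf_branch j ` level (n - j))"
proof (intro equalityI subsetI)
  fix x assume "x \<in> level n"
  then obtain a k where a: "\<forall>i\<ge>1. a i > 0" "x = cf_value a" "(\<Sum>i=1..k. a i) = n"
    unfolding level_def by blast
  then obtain l where k: "k = Suc l" using assms by (cases k) auto
  have sum: "n = a 1 + (\<Sum>i=1..l. a (Suc i))"
    using a(3) unfolding k by (simp add: sum.atLeast_Suc_atMost sum.shift_bounds_cl_Suc_ivl del: sum.cl_ivl_Suc)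
  have "cf_value (\<lambda>i. a (Suc i)) \<in> level (n - a 1)"
    unfolding level_def using a(1) sum by (intro CollectI exI[of _ "\<lambda>i. a (Suc i)"]) auto
  moreover have "a 1 \<in> {1..n}" using a(1) sum by (simp add: Suc_leI)
  ultimately show "x \<in> (\<Union>j\<in>{1..n}. cf_branch j ` level (n - j))"
    using cf_value_eq_branch[OF a(1)] a(2) by blast
next
  fix x assume "x \<in> (\<Union>j\<in>{1..n}. cf_branch j ` level (n - j))"
  then obtain j b k where j: "1 \<le> j" "j \<le> n" and b: "\<forall>i\<ge>1. b i > 0"
      "x = cf_branch j (cf_value b)" "(\<Sum>i=1..k. b i) = n - j"
    unfolding level_def by auto
  \<comment> \<open>The shift of \<open>a\<close> agrees with \<open>b\<close> except at the meaningless index \<open>0\<close>.\<close>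
  define a where "a i = (if i = 1 then j else b (i - 1))" for i
  have pos: "\<forall>i\<ge>1. a i > 0" using j b(1) by (auto simp: a_def)
  have "cf_value (\<lambda>i. a (Suc i)) = cf_value b"
    by (rule cf_value_cong) (simp add: a_def)
  moreover have "a 1 = j" by (simp add: a_def)
  ultimately have "x = cf_value a"
    using cf_value_eq_branch[OF pos] b(2) by simp
  moreover have "(\<Sum>i=1..Suc k. a i) = a 1 + (\<Sum>i=1..k. a (Suc i))"
    by (simp add: sum.atLeast_Suc_atMost sum.shift_bounds_cl_Suc_ivl del: sum.cl_ivl_Suc)
  moreover have "(\<Sum>i=1..k. a (Suc i)) = (\<Sum>i=1..k. b i)"
    by (rule sum.cong) (auto simp: a_def)
  ultimately show "x \<in> level n"
    unfolding level_def using pos b(3) j by (intro CollectI exI[of _ a] conjI exI[of _ "Suc k"]) (auto simp: a_def)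
qed

section \<open>The branches and the measure \<open>dx / x\<close>\<close>

lemma absolutely_integrable_inverse_shift:
  fixes c t :: real
  assumes "S \<in> sets lebesgue" "S \<subseteq> {c..1}" "t + c > 0"
  shows "(\<lambda>z. 1 / (t + z)) absolutely_integrable_on S"
proof (rule set_integrable_subset)
  show "(\<lambda>z. 1 / (t + z)) absolutely_integrable_on {c..1}"
    using assms(3) by (intro absolutely_integrable_continuous_real continuous_intros) auto
qed (use assms in auto)

lemma cf_branch_has_field_derivative:
  assumes "real j + z \<noteq> 0"
  shows "(cf_branch j has_field_derivative - 1 / (real j + z)\<^sup>2) (at z within S)"
  unfolding cf_branch_def
  by (rule derivative_eq_intros refl assms)+ (simp add: power2_eq_square)

lemma cf_branch_image_lebesgue:
  assumes "S \<in> sets lebesgue" "S \<subseteq> {0..1}" "j \<ge> 1"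
  shows "cf_branch j ` S \<in> sets lebesgue"
proof (rule differentiable_image_in_sets_lebesgue[OF assms(1)])
  have "real j + z \<noteq> 0" if "z \<in> S" for z using assms(2,3) that by force
  then have "cf_branch j field_differentiable (at z within S)" if "z \<in> S" for z
    using that cf_branch_has_field_derivative field_differentiable_def by blast
  then show "cf_branch j differentiable_on S"
    by (simp add: differentiable_on_def field_differentiable_imp_differentiable)
qed simp

text \<open>The factor \<open>1 / (j + z)\<^sup>2\<close> from the change of variables cancels against
  \<open>1 / x = j + z\<close> up to a single power: under \<open>x = 1 / (j + z)\<close> the measure \<open>dx / x\<close> becomes
  \<open>dz / (j + z)\<close>, a nearly uniform density.\<close>

lemma cf_branch_has_integral:
  assumes S: "S \<in> sets lebesgue" "S \<subseteq> {0..1}" and j: "j \<ge> 1"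
  shows "((\<lambda>x. 1 / x) has_integral integral S (\<lambda>z. 1 / (real j + z))) (cf_branch j ` S)"
proof -
  have pos: "real j + z > 0" if "z \<in> S" for z using S(2) j that by force
  let ?g' = "\<lambda>z. - 1 / (real j + z)\<^sup>2"
  have eq: "\<bar>?g' z\<bar> * (1 / cf_branch j z) = 1 / (real j + z)" if "z \<in> S" for z
    using pos[OF that] by (simp add: cf_branch_def power2_eq_square)
  have "(\<lambda>z. 1 / (real j + z)) absolutely_integrable_on S"
    using S j by (intro absolutely_integrable_inverse_shift[where c = 0]) auto
  then have "(\<lambda>z. \<bar>?g' z\<bar> * (1 / cf_branch j z)) absolutely_integrable_on S"
    by (rule absolutely_integrable_spike[OF _ negligible_empty]) (use eq in auto)
  moreover have "integral S (\<lambda>z. \<bar>?g' z\<bar> * (1 / cf_branch j z))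
      = integral S (\<lambda>z. 1 / (real j + z))"
    by (rule integral_cong) (rule eq)
  moreover have "inj_on (cf_branch j) S"
    by (rule inj_onI) (simp add: cf_branch_def)
  moreover have "(cf_branch j has_field_derivative ?g' z) (at z within S)" if "z \<in> S" for z
    using pos[OF that] by (intro cf_branch_has_field_derivative) simp
  ultimately have "(\<lambda>x. 1 / x) absolutely_integrable_on (cf_branch j ` S) \<and>
      integral (cf_branch j ` S) (\<lambda>x. 1 / x) = integral S (\<lambda>z. 1 / (real j + z))"
    using has_absolute_integral_change_of_variables_1'
      [OF S(1), of "cf_branch j" ?g' "\<lambda>x. 1 / x" "integral S (\<lambda>z. 1 / (real j + z))"] by blast
  then show ?thesis
    by (auto simp: has_integral_iff set_lebesgue_integral_eq_integral(1))
qed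

text \<open>Under \<open>x = y / (1 + y)\<close> the measure \<open>dx / x\<close> becomes
  \<open>dy / (y * (1 + y)) = dy / y - dy / (1 + y)\<close>. The lower bound \<open>c\<close> keeps both parts integrable.\<close>

lemma farey_branch_has_integral:
  fixes c :: real
  assumes S: "S \<in> sets lebesgue" "S \<subseteq> {c..1}" and c: "c > 0"
  shows "((\<lambda>x. 1 / x) has_integral
           (integral S (\<lambda>y. 1 / y) - integral S (\<lambda>y. 1 / (1 + y)))) ((\<lambda>y. y / (1 + y)) ` S)"
proof -
  let ?g = "\<lambda>y::real. y / (1 + y)" and ?g' = "\<lambda>y::real. 1 / (1 + y)\<^sup>2"
  let ?I = "integral S (\<lambda>y. 1 / y) - integral S (\<lambda>y. 1 / (1 + y))"
  have pos: "y > 0" if "y \<in> S" for y using S(2) c that by force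
  have eq: "\<bar>?g' y\<bar> * (1 / ?g y) = 1 / y - 1 / (1 + y)" if "y \<in> S" for y
  proof -
    have "y > 0" using pos[OF that] .
    then have "\<bar>?g' y\<bar> * (1 / ?g y) = 1 / (y * (1 + y))"
      by (simp add: power2_eq_square)
    also have "\<dots> = 1 / y - 1 / (1 + y)" using \<open>y > 0\<close> by (simp add: field_simps)
    finally show ?thesis .
  qed
  have int: "(\<lambda>y. 1 / y) absolutely_integrable_on S" "(\<lambda>y. 1 / (1 + y)) absolutely_integrable_on S"
    using absolutely_integrable_inverse_shift[OF S, of 0] absolutely_integrable_inverse_shift[OF S, of 1] c
    by simp_all
  then have "(\<lambda>y. 1 / y - 1 / (1 + y)) absolutely_integrable_on S"
    by (rule set_integral_diff(1))
  then have "(\<lambda>y. \<bar>?g' y\<bar> * (1 / ?g y)) absolutely_integrable_on S"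
    by (rule absolutely_integrable_spike[OF _ negligible_empty]) (use eq in auto)
  moreover have "integral S (\<lambda>y. \<bar>?g' y\<bar> * (1 / ?g y)) = ?I"
  proof -
    have "integral S (\<lambda>y. \<bar>?g' y\<bar> * (1 / ?g y)) = integral S (\<lambda>y. 1 / y - 1 / (1 + y))"
      by (rule integral_cong) (rule eq)
    also have "\<dots> = ?I"
      using int by (intro integral_diff set_lebesgue_integral_eq_integral(1))
    finally show ?thesis .
  qed
  moreover have "inj_on ?g S"
  proof (rule inj_onI)
    fix y w assume "y \<in> S" "w \<in> S" "?g y = ?g w"
    then show "y = w" using pos[of y] pos[of w] by (simp add: field_simps)
  qed
  moreover have "(?g has_field_derivative ?g' y) (at y within S)" if "y \<in> S" for y
    using pos[OF that] by (auto intro!: derivative_eq_intros simp: power2_eq_square)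
  ultimately have "(\<lambda>x. 1 / x) absolutely_integrable_on (?g ` S) \<and>
      integral (?g ` S) (\<lambda>x. 1 / x) = ?I"
    using has_absolute_integral_change_of_variables_1' [OF S(1), of ?g ?g' "\<lambda>x. 1 / x" ?I] by blast
  then show ?thesis
    by (auto simp: has_integral_iff set_lebesgue_integral_eq_integral(1))
qed

section \<open>Every level set has logarithmic mass \<open>ln 2\<close>\<close>

text \<open>Only rational numbers can lack an infinite expansion.\<close>

lemma negligible_unit_diff_level_0: "negligible ({0..1} - level 0)"
proof (rule negligible_subset)
  show "negligible (\<rat> :: real set)"
    unfolding negligible_iff_null_sets
    using countable_rat by (intro null_sets_completionI countable_imp_null_set_lborel)
  show "{0..1} - level 0 \<subseteq> \<rat>"
    using irrational_is_cf_value unfolding level_0 by blast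
qed

lemma level_lebesgue: "level n \<in> sets lebesgue"
proof (induction n rule: less_induct)
  case (less n)
  show ?case
  proof (cases "n = 0")
    case True
    have "{0..1} - level 0 \<in> sets lebesgue"
      using negligible_unit_diff_level_0 by (rule negligible_imp_sets)
    moreover have "level 0 = {0..1} - ({0..1} - level 0)"
      using level_subset[of 0] by blast
    ultimately show ?thesis
      unfolding True by (metis sets.Diff atLeastAtMost_borel sets_completionI_sets sets_lborel)
  next
    case False
    then have "level n = (\<Union>j\<in>{1..n}. cf_branch j ` level (n - j))"
      by (intro level_first_digit) simp
    also have "\<dots> \<in> sets lebesgue"
      using False less level_subset by (intro sets.finite_UN cf_branch_image_lebesgue) auto
    finally show ?thesis .
  qed
qed

lemma level_lower_bound:
  assumes "n \<ge> 1"
  shows "level n \<subseteq> {1 / (real n + 1)..1}"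
proof
  fix x assume "x \<in> level n"
  then obtain j z where jz: "1 \<le> j" "j \<le> n" "z \<in> level (n - j)" "x = cf_branch j z"
    unfolding level_first_digit[OF assms] by auto
  then have "0 \<le> z" "z \<le> 1" using level_subset[of "n - j"] by auto
  then show "x \<in> {1 / (real n + 1)..1}"
    using jz(1,2,4) by (auto simp: cf_branch_def intro!: divide_left_mono)
qed

text \<open>The images of the unit interval under two branches meet in at most one endpoint, so the parts
  of a level set with different first digits are disjoint for the purpose of integration.\<close>

lemma cf_branch_overlap:
  assumes "S \<subseteq> {0..1}" "T \<subseteq> {0..1}" "1 \<le> i" "1 \<le> j" "i \<noteq> j"
  shows "negligible (cf_branch i ` S \<inter> cf_branch j ` T)"
proof (rule negligible_subset)
  show "negligible {1 / real i, 1 / real j}" by simp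
  show "cf_branch i ` S \<inter> cf_branch j ` T \<subseteq> {1 / real i, 1 / real j}"
  proof
    fix x assume "x \<in> cf_branch i ` S \<inter> cf_branch j ` T"
    then obtain z w where zw: "z \<in> S" "w \<in> T" "x = 1 / (real i + z)" "x = 1 / (real j + w)"
      by (auto simp: cf_branch_def)
    then have "0 \<le> z" "z \<le> 1" "0 \<le> w" "w \<le> 1" using assms(1,2) by auto
    moreover from zw have "real i + z = real j + w" by simp
    moreover have "real i + 1 \<le> real j \<or> real j + 1 \<le> real i" using assms(5) by linarith
    ultimately have "z = 0 \<or> w = 0" by linarith
    then show "x \<in> {1 / real i, 1 / real j}" using zw(3,4) by auto
  qed
qed

lemma has_integral_level_first_digit:
  assumes "n \<ge> 1"
  shows "((\<lambda>x. 1 / x) has_integral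
           (\<Sum>j=1..n. integral (level (n - j)) (\<lambda>z. 1 / (real j + z)))) (level n)"
  unfolding level_first_digit[OF assms]
proof (rule has_integral_UN)
  show "pairwise (\<lambda>i i'. negligible (cf_branch i ` level (n - i) \<inter> cf_branch i' ` level (n - i'))) {1..n}"
    using level_subset by (auto simp: pairwise_def intro!: cf_branch_overlap)
qed (use level_subset level_lebesgue in \<open>auto intro!: cf_branch_has_integral\<close>)

text \<open>This is the Farey map in disguise. Its two inverse branches are \<open>1 / (1 + y)\<close>, which puts a
  digit \<open>1\<close> in front, and \<open>y / (1 + y)\<close>, which raises the first digit by one; both raise
  the digit sum by one.\<close>

lemma level_Suc:
  assumes "n \<ge> 1"
  shows "level (Suc n) = cf_branch 1 ` level n \<union> (\<lambda>y. y / (1 + y)) ` level n"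
proof -
  have comp: "cf_branch j z / (1 + cf_branch j z) = cf_branch (Suc j) z"
    if "1 \<le> j" "z \<in> level m" for j z m
  proof -
    have "real j + z > 0" using that level_subset[of m] by force
    then show ?thesis by (simp add: cf_branch_def field_simps)
  qed
  have ins: "{1..Suc n} = insert 1 (Suc ` {1..n})"
    unfolding image_Suc_atLeastAtMost using assms by auto
  have "level (Suc n) = (\<Union>j\<in>{1..Suc n}. cf_branch j ` level (Suc n - j))"
    by (rule level_first_digit) simp
  also have "\<dots> = cf_branch 1 ` level n \<union> (\<Union>j\<in>{1..n}. cf_branch (Suc j) ` level (n - j))"
    unfolding ins UN_insert image_image diff_Suc_Suc by simp
  also have "(\<Union>j\<in>{1..n}. cf_branch (Suc j) ` level (n - j))
      = (\<Union>j\<in>{1..n}. (\<lambda>y. y / (1 + y)) ` cf_branch j ` level (n - j))"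
    unfolding image_image by (intro SUP_cong image_cong refl) (simp_all add: comp)
  also have "\<dots> = (\<lambda>y. y / (1 + y)) ` level n"
    unfolding level_first_digit[OF assms] image_UN ..
  finally show ?thesis .
qed

text \<open>The measure \<open>dx / x\<close> is invariant under the Farey map: the two branches contribute
  \<open>1 / (1 + y)\<close> and \<open>1 / y - 1 / (1 + y)\<close>, which add up to \<open>1 / y\<close>. So every level set has the same
  mass as the first one, which is \<open>{1 / 2..1}\<close> up to a null set. (The level \<open>0\<close>, nearly the whole unit
  interval, has infinite mass and is excluded.)\<close>

lemma level_log_measure:
  assumes "n \<ge> 1"
  shows "((\<lambda>x. 1 / x) has_integral ln 2) (level n)"
  using assms
proof (induction n rule: nat_induct_at_least)
  case base
  have "((\<lambda>z::real. 1 / (1 + z)) has_integral (ln (1 + 1) - ln (1 + 0))) {0..1}"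
    by (rule fundamental_theorem_of_calculus)
       (auto intro!: derivative_eq_intros simp: has_real_derivative_iff_has_vector_derivative[symmetric])
  then have "((\<lambda>z::real. 1 / (1 + z)) has_integral ln 2) {0..1}" by simp
  moreover have "negligible {z \<in> {0..1} - level 0. 1 / (1 + z) \<noteq> 0}"
    by (rule negligible_subset[OF negligible_unit_diff_level_0]) auto
  moreover have "negligible {z \<in> level 0 - {0..1}. 1 / (1 + z) \<noteq> 0}"
    by (rule negligible_subset[OF negligible_empty]) (use level_subset[of 0] in auto)
  ultimately have "((\<lambda>z::real. 1 / (1 + z)) has_integral ln 2) (level 0)"
    using has_integral_spike_set_eq[of "{0..1}" "level 0" "\<lambda>z::real. 1 / (1 + z)" "ln 2"] by blast
  then show ?case
    using has_integral_level_first_digit[of 1] by (simp add: integral_unique)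
next
  case (Suc n)
  have pos: "(0::real) < 1 / (real n + 1)" by simp
  note lower = level_lower_bound[OF Suc.hyps(1)]
  have "(\<lambda>y. y / (1 + y)) ` level n \<inter> cf_branch 1 ` level n \<subseteq> {1 / 2}"
  proof
    fix x assume "x \<in> (\<lambda>y. y / (1 + y)) ` level n \<inter> cf_branch 1 ` level n"
    then obtain y z where yz: "y \<in> level n" "z \<in> level n" "x = y / (1 + y)" "x = 1 / (1 + z)"
      by (auto simp: cf_branch_def)
    have "0 \<le> y" "y \<le> 1" "0 \<le> z" "z \<le> 1" using level_subset[of n] yz by auto
    then have "y / (1 + y) \<le> 1 / 2" "1 / (1 + z) \<ge> 1 / 2" by (simp_all add: field_simps)
    then have "x \<le> 1 / 2" "x \<ge> 1 / 2" using yz(3,4) by linarith+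
    then show "x \<in> {1 / 2}" by simp
  qed
  then have "negligible ((\<lambda>y. y / (1 + y)) ` level n \<inter> cf_branch 1 ` level n)"
    by (rule negligible_subset[rotated]) simp
  from has_integral_Un[OF farey_branch_has_integral[OF level_lebesgue lower pos]
      cf_branch_has_integral[OF level_lebesgue level_subset, of 1 n] this]
  show ?case
    using Suc.IH by (simp add: level_Suc[OF Suc.hyps(1)] Un_commute integral_unique)
qed

section \<open>The renewal inequalities for Lebesgue measure\<close>

lemma level_measure_bounds:
  assumes "j \<ge> 1"
  shows "measure lebesgue (level m) / (real j + 1) \<le> integral (level m) (\<lambda>z. 1 / (real j + z))"
    and "integral (level m) (\<lambda>z. 1 / (real j + z)) \<le> measure lebesgue (level m) / real j"
proof -
  have lm: "level m \<in> lmeasurable"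
    using level_lebesgue level_subset by (intro bounded_set_imp_lmeasurable) (auto intro: bounded_subset[OF bounded_closed_interval])
  have "((\<lambda>_. 1::real) has_integral measure lebesgue (level m)) (level m)"
    using lm by (simp add: lmeasure_integral integrable_on_const integrable_integral)
  then have const: "((\<lambda>z. 1 / c) has_integral measure lebesgue (level m) / c) (level m)" for c :: real
    by (rule has_integral_divide)
  have "(\<lambda>z. 1 / (real j + z)) absolutely_integrable_on level m"
    using level_lebesgue level_subset assms by (intro absolutely_integrable_inverse_shift[where c = 0]) auto
  then have int: "((\<lambda>z. 1 / (real j + z)) has_integral integral (level m) (\<lambda>z. 1 / (real j + z))) (level m)"
    by (intro integrable_integral set_lebesgue_integral_eq_integral(1))
  show "measure lebesgue (level m) / (real j + 1) \<le> integral (level m) (\<lambda>z. 1 / (real j + z))"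
    by (rule has_integral_le[OF const int]) (use level_subset[of m] assms in \<open>force intro!: divide_left_mono\<close>)
  show "integral (level m) (\<lambda>z. 1 / (real j + z)) \<le> measure lebesgue (level m) / real j"
    by (rule has_integral_le[OF int const]) (use level_subset[of m] assms in \<open>force intro!: divide_left_mono\<close>)
qed

text \<open>Computing the mass \<open>ln 2\<close> of \<open>level n\<close> once more, now by the first digit, gives sums of the
  integrals of \<open>1 / (j + z)\<close> over the lower levels. That density lies between
  \<open>1 / (j + 1)\<close> and \<open>1 / j\<close>, so Lebesgue measure satisfies a renewal equation up to this small error.\<close>

lemma level_renewal_bounds:
  assumes "n \<ge> 1"
  shows "(\<Sum>j=1..n. measure lebesgue (level (n - j)) / (real j + 1)) \<le> ln 2"
    and "ln 2 \<le> (\<Sum>j=1..n. measure lebesgue (level (n - j)) / real j)"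
proof -
  have eq: "(\<Sum>j=1..n. integral (level (n - j)) (\<lambda>z. 1 / (real j + z))) = ln 2"
    using has_integral_unique[OF has_integral_level_first_digit level_log_measure] assms by blast
  show "(\<Sum>j=1..n. measure lebesgue (level (n - j)) / (real j + 1)) \<le> ln 2"
    unfolding eq[symmetric] by (intro sum_mono level_measure_bounds) simp
  show "ln 2 \<le> (\<Sum>j=1..n. measure lebesgue (level (n - j)) / real j)"
    unfolding eq[symmetric] by (intro sum_mono level_measure_bounds) simp
qed

section \<open>Asymptotics of partial sums from a harmonic renewal inequality\<close>

lemma harm_le_1_plus_ln:
  assumes "n \<ge> 1"
  shows "harm n \<le> 1 + ln (real n)"
  using euler_mascheroni_sequence_decreasing[of 1 n] assms by (simp add: harm_def)

lemma sum_convolution: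
  fixes v w :: "nat \<Rightarrow> real"
  shows "(\<Sum>n=1..N. \<Sum>j=1..n. v j * w (n - j)) = (\<Sum>j=1..N. v j * (\<Sum>k\<le>N - j. w k))"
proof (induction N)
  case (Suc N)
  have "(\<Sum>j=1..N. v j * (\<Sum>k\<le>Suc N - j. w k))
      = (\<Sum>j=1..N. v j * (\<Sum>k\<le>N - j. w k) + v j * w (Suc N - j))"
    by (rule sum.cong) (auto simp: Suc_diff_le algebra_simps)
  then show ?case using Suc by (simp add: sum.distrib)
qed simp

text \<open>Let \<open>B\<close> be the partial sums of \<open>w\<close>. Summing the hypotheses gives
  \<open>(\<Sum>j=1..n. B (n - j) / (j + 1)) \<le> c * n \<le> (\<Sum>j=1..n. B (n - j) / j)\<close>.
  As \<open>B\<close> increases, the right sum is at most \<open>B n\<close> times a harmonic number, a bound of the correct order.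
  In the other direction the left inequality at \<open>n + m\<close>, restricted to \<open>j \<le> m\<close>, bounds \<open>B n\<close>
  by \<open>c * (n + m)\<close> over about \<open>ln m\<close>. Since \<open>ln\<close> varies slowly, some \<open>m\<close> is
  negligible against \<open>n\<close> while \<open>ln m\<close> is asymptotic to \<open>ln n\<close>, so the two bounds meet.\<close>

lemma renewal_sums_asymp:
  fixes w :: "nat \<Rightarrow> real"
  assumes c: "c > 0" and nonneg: "\<And>n. w n \<ge> 0"
    and le: "\<And>n. n \<ge> 1 \<Longrightarrow> (\<Sum>j=1..n. w (n - j) / (real j + 1)) \<le> c"
    and ge: "\<And>n. n \<ge> 1 \<Longrightarrow> c \<le> (\<Sum>j=1..n. w (n - j) / real j)"
  shows "(\<lambda>n. \<Sum>k=1..n. w k) \<sim>[sequentially] (\<lambda>n. c * real n / ln (real n))"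
proof -
  define B where "B n = (\<Sum>k\<le>n. w k)" for n
  have B_nonneg: "B n \<ge> 0" for n unfolding B_def by (intro sum_nonneg nonneg)
  have B_mono: "B m \<le> B n" if "m \<le> n" for m n
    unfolding B_def using that nonneg by (intro sum_mono2) auto
  have B_eq: "(\<Sum>k=1..n. w k) = B n - w 0" for n
    unfolding B_def by (simp add: atMost_atLeast0 sum.atLeast_Suc_atMost)
  have lower: "real n * c / (1 + ln (real n)) \<le> B n" if n: "n \<ge> 1" for n
  proof -
    have "real n * c = (\<Sum>m=1..n. c)" by simp
    also have "\<dots> \<le> (\<Sum>m=1..n. \<Sum>j=1..m. w (m - j) / real j)"
      using ge by (intro sum_mono) auto
    also have "\<dots> = (\<Sum>j=1..n. B (n - j) / real j)"
      using sum_convolution[of "\<lambda>j. 1 / real j" w n] by (simp add: B_def)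
    also have "\<dots> \<le> (\<Sum>j=1..n. B n / real j)"
      by (intro sum_mono divide_right_mono B_mono) auto
    also have "\<dots> = B n * harm n"
      by (simp add: harm_def sum_distrib_left divide_inverse)
    also have "\<dots> \<le> B n * (1 + ln (real n))"
      by (intro mult_left_mono harm_le_1_plus_ln n B_nonneg)
    finally show ?thesis using n by (simp add: divide_le_eq add_pos_nonneg)
  qed
  have upper: "B n * (ln (real m + 2) - 1) \<le> (real n + real m) * c" for n m
  proof -
    have "harm (Suc m) = 1 + (\<Sum>j=1..m. 1 / (real j + 1))"
      unfolding harm_def
      by (subst sum.atLeast_Suc_atMost) (simp_all add: sum.shift_bounds_cl_Suc_ivl divide_inverse add.commute del: sum.cl_ivl_Suc)
    moreover have "ln (real m + 2) \<le> harm (Suc m)"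
      using ln_le_harm[of "Suc m"] by (simp add: add.commute add.left_commute)
    ultimately have "B n * (ln (real m + 2) - 1) \<le> B n * (\<Sum>j=1..m. 1 / (real j + 1))"
      by (intro mult_left_mono B_nonneg) simp
    also have "\<dots> = (\<Sum>j=1..m. B n / (real j + 1))"
      by (simp add: sum_distrib_left)
    also have "\<dots> \<le> (\<Sum>j=1..m. B (n + m - j) / (real j + 1))"
      by (intro sum_mono divide_right_mono B_mono) auto
    also have "\<dots> \<le> (\<Sum>j=1..n + m. B (n + m - j) / (real j + 1))"
      by (intro sum_mono2) (auto intro!: divide_nonneg_nonneg B_nonneg)
    also have "\<dots> = (\<Sum>k=1..n + m. \<Sum>j=1..k. w (k - j) / (real j + 1))"
      using sum_convolution[of "\<lambda>j. 1 / (real j + 1)" w "n + m"] by (simp add: B_def)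
    also have "\<dots> \<le> (\<Sum>k=1..n + m. c)"
      using le by (intro sum_mono) auto
    finally show ?thesis by simp
  qed
  show ?thesis
  proof (rule asymp_equiv_sandwich_real)
    let ?l = "\<lambda>n. real n * c / (1 + ln (real n)) - w 0"
    let ?u = "\<lambda>n. (real n + real n / ln (real n)) * c / (ln (real n / ln (real n)) - 1)"
    show "?l \<sim>[sequentially] (\<lambda>n. c * real n / ln (real n))"
      using c by real_asymp
    show "?u \<sim>[sequentially] (\<lambda>n. c * real n / ln (real n))"
      using c by real_asymp
    have "\<forall>\<^sub>F n in sequentially. ln (real n / ln (real n)) - 1 > 0"
      by real_asymp
    moreover have "\<forall>\<^sub>F n in sequentially. real n / ln (real n) > 0"
      by real_asymp
    ultimately show "\<forall>\<^sub>F n in sequentially. (\<Sum>k=1..n. w k) \<in> {?l n..?u n}"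
      using eventually_ge_at_top[of "1::nat"]
    proof eventually_elim
      case (elim n)
      \<comment> \<open>With \<open>m\<close> about \<open>n / ln n\<close> the factor \<open>n + m\<close> is asymptotic to \<open>n\<close>, and \<open>ln m\<close>
        differs from \<open>ln n\<close> only by about \<open>ln (ln n)\<close>.\<close>
      define r where "r = real n / ln (real n)"
      define m where "m = nat \<lfloor>r\<rfloor>"
      have m: "real m \<le> r" "r \<le> real m + 2"
        using elim(2) unfolding m_def r_def[symmetric] by linarith+
      have "B n * (ln r - 1) \<le> B n * (ln (real m + 2) - 1)"
        using elim(2) m(2) unfolding r_def[symmetric] by (intro mult_left_mono B_nonneg) simp
      also have "\<dots> \<le> (real n + real m) * c" by (rule upper)
      also have "\<dots> \<le> (real n + r) * c" using m(1) c by simp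
      finally have "B n \<le> ?u n"
        using elim(1) unfolding r_def[symmetric] by (simp add: pos_le_divide_eq)
      then show ?case using lower[OF elim(3)] nonneg[of 0] unfolding B_eq by simp
    qed
  qed
qed

theorem theorem1p2:
  "(\<lambda>n::nat. \<Sum>k=1..n. measure (lebesgue_on {0..1}) (sum_level_set k))
     \<sim>[sequentially] (\<lambda>n. real n / log 2 (real n))"
proof -
  have "measure (lebesgue_on {0..1}) (sum_level_set k) = measure lebesgue (level k)"
    if "k \<ge> 1" for k
    using that level_subset[of k] by (simp add: level_eq_sum_level_set[symmetric] measure_restrict_space)
  then have "(\<lambda>n. \<Sum>k=1..n. measure (lebesgue_on {0..1}) (sum_level_set k))
      = (\<lambda>n. \<Sum>k=1..n. measure lebesgue (level k))"
    by (intro ext sum.cong) auto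
  moreover have "(\<lambda>n. \<Sum>k=1..n. measure lebesgue (level k))
      \<sim>[sequentially] (\<lambda>n. ln 2 * real n / ln (real n))"
    by (rule renewal_sums_asymp) (use level_renewal_bounds in auto)
  moreover have "(\<lambda>n. ln 2 * real n / ln (real n)) = (\<lambda>n. real n / log 2 (real n))"
    by (simp add: log_def mult.commute)
  ultimately show ?thesis by simp
qed

end
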